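(* Let $\mathcal{P}\subset\mathbb{R}^2$ be a point cloud, $p\ge1$ an integer, and $\mathbf{x}=[x_1,\dots,x_{n+p+1}]$ a $(p+1)$-regular knot vector with boundary knots $x_{p+1}=a$ and $x_{n+1}=b$. Let $w_t:\mathbb{R}\to[0,+\infty)$, $t\in\mathbb{R}$, be a family of weight functions and let $f_w$ be the weighted quasi interpolant spline approximation of degree $p$ to $\mathcal{P}$ over $\mathbf{x}$. If $\mathcal{P}$ is $w$-convex (respectively $w$-concave), then $f_w$ is convex (respectively concave) on $[a,b]$.
   Context: A point cloud is a finite nonempty set of points. B-splines. For a non-decreasing local knot vector $\mathbf{t}=[t_1,\dots,t_{p+2}]$, the B-spline $B[\mathbf{t}]:\mathbb{R}\to\mathbb{R}$ of degree $p$ is defined recursively by $$B[\mathbf{t}](x)=\frac{x-t_1}{t_{p+1}-t_1}B[t_1,\dots,t_{p+1}](x)+\frac{t_{p+2}-x}{t_{p+2}-t_2}B[t_2,\dots,t_{p+2}](x),$$ with $B[t_i,t_{i+1}](x)=1$ if $x\in[t_i,t_{i+1})$ and $0$ otherwise; terms with zero denominator are taken to be $0$ (convention $0/0=0$). For a global non-decreasing knot vector $\mathbf{x}=[x_1,\dots,x_{n+p+1}]$ put $\mathbf{x}^{(i)}=[x_i,\dots,x_{i+p+1}]$, $i=1,\dots,n$. At the right end point $x_{n+1}$ of $[x_{p+1},x_{n+1}]$, the B-splines are evaluated as limits from the left. A knot vector $\mathbf{x}=[x_1,\dots,x_{n+p+1}]$ is $(p+1)$-regular if $n\ge p+1$,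 $x_1=x_{p+1}$, $x_{n+1}=x_{n+p+1}$, and $x_j<x_{j+p+1}$ for $j=1,\dots,n$. Weighted quasi interpolant spline approximation (wQISA) of degree $p$ to $\mathcal{P}$ over $\mathbf{x}$: $$f_w(x)=\sum_{i=1}^n\hat y_w(\xi^{(i)})\,B[\mathbf{x}^{(i)}](x),$$ where $\xi^{(i)}=(x_{i+1}+\dots+x_{i+p})/p$ are the knot averages and $$\hat y_w(t)=\frac{\sum_{(x,y)\in\mathcal{P}}y\,w_t(x)}{\sum_{(x,y)\in\mathcal{P}}w_t(x)},\qquad t\in\mathbb{R}.$$ It is assumed that the denominator is positive for every $t\in\mathbb{R}$, so that $\hat y_w:\mathbb{R}\to\mathbb{R}$ is well defined. $w$-convexity: $\mathcal{P}$ is $w$-convex if for all real $x_1\le x_2$ and all $\lambda\in[0,1]$, $$\hat y_w((1-\lambda)x_1+\lambda x_2)\le(1-\lambda)\hat y_w(x_1)+\lambda\hat y_w(x_2).$$ $\mathcal{P}$ is $w$-concave if $\mathcal{P}_-=\{(x,-y):(x,y)\in\mathcal{P}\}$ is $w$-convex (with the same weight functions $w_t$, the estimator $\hat y_w$ being computed from $\mathcal{P}_-$). *)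

theory Defs
  imports "HOL-Analysis.Analysis"
begin

text \<open>
  A knot vector $[x_1,\dots,x_{n+p+1}]$ is a function \<open>x :: nat \<Rightarrow> real\<close> of which only the values at
  the indices \<open>1, \<dots>, n + p + 1\<close> matter.
\<close>

text \<open>
  \<open>bspline x p i\<close> is the degree \<open>p\<close> B-spline $B[x_i,\dots,x_{i+p+1}]$ on the \<open>i\<close>-th local knot vector
  of \<open>x\<close>.  The convention that terms with zero denominator vanish is \<open>a / 0 = 0\<close>.
\<close>
fun bspline :: "(nat \<Rightarrow> real) \<Rightarrow> nat \<Rightarrow> nat \<Rightarrow> real \<Rightarrow> real" where
  "bspline x 0 i u = (if x i \<le> u \<and> u < x (i + 1) then 1 else 0)"
| "bspline x (Suc p) i u =
     (u - x i) / (x (i + p + 1) - x i) * bspline x p i u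
     + (x (i + p + 2) - u) / (x (i + p + 2) - x (i + 1)) * bspline x p (i + 1) u"

text \<open>At the right end point $x_{n+1}$ the B-splines are evaluated as limits from the left.\<close>
definition bspline_eval :: "(nat \<Rightarrow> real) \<Rightarrow> nat \<Rightarrow> nat \<Rightarrow> nat \<Rightarrow> real \<Rightarrow> real" where
  "bspline_eval x p n i u =
     (if u = x (n + 1) then Lim (at_left u) (bspline x p i) else bspline x p i u)"

text \<open>\<open>regular_knots p n x\<close>: the knot vector is non-decreasing and $(p+1)$-regular.\<close>
definition regular_knots :: "nat \<Rightarrow> nat \<Rightarrow> (nat \<Rightarrow> real) \<Rightarrow> bool" where
  "regular_knots p n x \<longleftrightarrow>
     mono_on {1..n + p + 1} x \<and> p + 1 \<le> n \<and> x 1 = x (p + 1) \<and> x (n + 1) = x (n + p + 1) \<and>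
     (\<forall>j\<in>{1..n}. x j < x (j + p + 1))"

definition knot_average :: "(nat \<Rightarrow> real) \<Rightarrow> nat \<Rightarrow> nat \<Rightarrow> real" where
  "knot_average x p i = (\<Sum>j = i + 1..i + p. x j) / real p"

definition estimator :: "(real \<times> real) set \<Rightarrow> (real \<Rightarrow> real \<Rightarrow> real) \<Rightarrow> real \<Rightarrow> real" where
  "estimator P w t = (\<Sum>(x, y)\<in>P. y * w t x) / (\<Sum>(x, y)\<in>P. w t x)"

definition wqisa ::
  "(real \<times> real) set \<Rightarrow> (real \<Rightarrow> real \<Rightarrow> real) \<Rightarrow> nat \<Rightarrow> nat \<Rightarrow> (nat \<Rightarrow> real) \<Rightarrow> real \<Rightarrow> real" where
  "wqisa P w p n x u =
     (\<Sum>i = 1..n. estimator P w (knot_average x p i) * bspline_eval x p n i u)"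

definition w_convex :: "(real \<Rightarrow> real \<Rightarrow> real) \<Rightarrow> (real \<times> real) set \<Rightarrow> bool" where
  "w_convex w P \<longleftrightarrow>
     (\<forall>x1 x2 l. x1 \<le> x2 \<longrightarrow> l \<in> {0..1} \<longrightarrow>
        estimator P w ((1 - l) * x1 + l * x2)
          \<le> (1 - l) * estimator P w x1 + l * estimator P w x2)"

definition w_concave :: "(real \<Rightarrow> real \<Rightarrow> real) \<Rightarrow> (real \<times> real) set \<Rightarrow> bool" where
  "w_concave w P \<longleftrightarrow> w_convex w ((\<lambda>(x, y). (x, - y)) ` P)"

end

theory Submission
  imports Defs
begin

text \<open>
  Write $\xi_i$ for the knot averages and $f$ for the estimator.  For a
  \<open>w\<close>-convex cloud $f$ is convex on the whole line, so the claim is that the Schoenberg operator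
  $f \mapsto \sum_i f(\xi_i) B_{i,p}$ preserves convexity.  The usual reason is that the derivative of
  a spline is a spline of one degree less whose coefficients are divided differences of the original
  ones: for a convex $f$ the slopes $s_k = (f(\xi_k) - f(\xi_{k-1})) / (\xi_k - \xi_{k-1})$ increase
  with $k$, and a spline with increasing coefficients is increasing.

  Both halves of this argument become transparent for the tail sums $T_{k,q} = \sum_{i \ge k} B_{i,q}$.
  Each of them rises from 0 to 1 over $[x_k, x_{k+q}]$ and has the one-term derivative
  $T_{k,q}' = q\, B_{k,q-1} / (x_{k+q} - x_k)$ away from the knots (\<open>bspline_tail_has_derivative\<close>),
  hence is increasing (\<open>bspline_tail_mono\<close>).  Summation by parts (\<open>sum_bspline_eq\<close>) turns a spline
  with coefficients $c_i$ into a constant plus $\sum_k (c_k - c_{k-1}) T_{k,q}$.  Applied in degree $p$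
  with $c_i = f(\xi_i)$ it gives the derivative $\sum_k s_k B_{k,p-1}$, because
  $\xi_k - \xi_{k-1} = (x_{k+p} - x_k) / p$ cancels the factor in $T_{k,p}'$; applied again in degree
  $p - 1$ with $c_k = s_k$ it shows that this derivative is increasing (\<open>convex_on_spline\<close>).

  Repeated knots need attention, as a knot of multiplicity $p + 1$ is allowed in the interior.  There
  the individual B-splines jump.  The spline does not: $T_{k,p}$ jumps only if $x_k = x_{k+p}$, and then
  $\xi_k = \xi_{k-1}$, so that $T_{k,p}$ has the coefficient $0$.  Hence the spline is a continuous
  function with an increasing derivative off finitely many points, and the fundamental theorem of
  calculus makes it convex (\<open>convex_on_of_mono_derivative\<close>).  The same continuity identifies its
  value at the right end point with the limit from the left.

  The concave case is the convex one for the reflected cloud, as the estimator and with it the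
  approximation change sign.
\<close>

section \<open>Convexity and derivatives\<close>

lemma convex_on_eq:
  assumes "\<And>u. u \<in> S \<Longrightarrow> f u = g u" and "convex_on S g"
  shows "convex_on S f"
proof (rule convex_onI)
  show "convex S"
    using assms(2) by (rule convex_on_imp_convex)
  fix t :: real and u v
  assume *: "0 < t" "t < 1" "u \<in> S" "v \<in> S"
  then have "(1 - t) *\<^sub>R u + t *\<^sub>R v \<in> S"
    using convexD_alt[OF \<open>convex S\<close>, of u v t] by simp
  then show "f ((1 - t) *\<^sub>R u + t *\<^sub>R v) \<le> (1 - t) * f u + t * f v"
    using * convex_onD[OF assms(2), of t u v] by (simp add: assms(1))
qed

lemma increment_ge_of_derivative_ge:
  fixes F g :: "real \<Rightarrow> real"
  assumes "finite S" and "a \<le> b" and "continuous_on {a..b} F"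
    and "\<And>t. t \<in> {a<..<b} - S \<Longrightarrow> (F has_real_derivative g t) (at t)"
    and "\<And>t. t \<in> {a..b} \<Longrightarrow> c \<le> g t"
  shows "c * (b - a) \<le> F b - F a"
proof -
  have g: "(g has_integral (F b - F a)) {a..b}"
    using assms(1-4)
    by (intro fundamental_theorem_of_calculus_interior_strong[of S])
      (auto simp: has_real_derivative_iff_has_vector_derivative)
  have const: "((\<lambda>_. c) has_integral c * (b - a)) {a..b}"
    using has_integral_const_real[of c a b] \<open>a \<le> b\<close> by (simp add: mult.commute)
  show ?thesis
    by (rule has_integral_le[OF const g]) (rule assms(5))
qed

text \<open>
  The function \<open>g\<close> is total and increasing also at the exceptional points and at the end points, so
  its values serve as subgradients of \<open>F\<close> everywhere, and no limit argument at the end points is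
  needed.
\<close>
lemma convex_on_of_mono_derivative:
  fixes F g :: "real \<Rightarrow> real"
  assumes "finite S" and "continuous_on {a..b} F"
    and deriv: "\<And>t. t \<in> {a<..<b} - S \<Longrightarrow> (F has_real_derivative g t) (at t)"
    and "mono g"
  shows "convex_on {a..b} F"
proof (rule pos_convex_function)
  fix s t
  assume st: "s \<in> {a..b}" "t \<in> {a..b}"
  show "g s * (t - s) \<le> F t - F s"
  proof (cases "s \<le> t")
    case True
    show ?thesis
    proof (rule increment_ge_of_derivative_ge[OF \<open>finite S\<close> True])
      show "continuous_on {s..t} F"
        using assms(2) st by (rule_tac continuous_on_subset) auto
      show "(F has_real_derivative g r) (at r)" if "r \<in> {s<..<t} - S" for r
        using that st by (intro deriv) auto
      show "g s \<le> g r" if "r \<in> {s..t}" for r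
        using that \<open>mono g\<close> by (auto intro: monoD)
    qed
  next
    case False
    have "- g s * (s - t) \<le> - F s - - F t"
    proof (rule increment_ge_of_derivative_ge[OF \<open>finite S\<close>])
      show "continuous_on {t..s} (\<lambda>r. - F r)"
        using continuous_on_subset[OF assms(2), of "{t..s}"] st
        by (intro continuous_intros) auto
      show "((\<lambda>r. - F r) has_real_derivative - g r) (at r)" if "r \<in> {t<..<s} - S" for r
        using that st by (intro DERIV_minus deriv) auto
      show "- g s \<le> - g r" if "r \<in> {t..s}" for r
        using that \<open>mono g\<close> by (auto dest: monoD)
    qed (use False in simp)
    then show ?thesis
      by (simp add: algebra_simps)
  qed
qed simp

lemma convex_on_subgradient:
  fixes f :: "real \<Rightarrow> real"
  assumes "convex_on UNIV f"
  obtains d where "\<And>s t. f s + d s * (t - s) \<le> f t"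
proof -
  have "f s + Inf ((\<lambda>t. (f s - f t) / (s - t)) ` ({s<..} \<inter> UNIV)) * (t - s) \<le> f t" for s t
    by (rule convex_le_Inf_differential[OF assms]) simp_all
  then show thesis
    using that[of "\<lambda>s. Inf ((\<lambda>t. (f s - f t) / (s - t)) ` ({s<..} \<inter> UNIV))"] by blast
qed

text \<open>
  The nodes may coincide, and then the difference quotient is undefined.  A subgradient at the common
  node fills the gap: a subgradient at a point lies between the difference quotients to its left and to
  its right, which is also why the slopes increase.
\<close>
lemma convex_on_obtains_slopes:
  fixes f :: "real \<Rightarrow> real" and \<xi> :: "nat \<Rightarrow> real"
  assumes "convex_on UNIV f" and "mono \<xi>"
  obtains s where "\<And>k. s k \<le> s (k + 1)"
    and "\<And>k. f (\<xi> (k + 1)) - f (\<xi> k) = s (k + 1) * (\<xi> (k + 1) - \<xi> k)"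
proof -
  obtain d where d: "\<And>s t. f s + d s * (t - s) \<le> f t"
    using convex_on_subgradient[OF assms(1)] by blast
  define \<sigma> where "\<sigma> u v = (if u = v then d u else (f v - f u) / (v - u))" for u v
  have \<sigma>_le: "\<sigma> u v \<le> d v" and le_\<sigma>: "d u \<le> \<sigma> u v" if "u \<le> v" for u v
  proof -
    have "(f v - f u) / (v - u) \<le> d v" if "u < v"
      using that d[of v u] by (simp add: divide_le_eq algebra_simps)
    then show "\<sigma> u v \<le> d v"
      using that by (simp add: \<sigma>_def)
    have "d u \<le> (f v - f u) / (v - u)" if "u < v"
      using that d[of u v] by (simp add: le_divide_eq algebra_simps)
    then show "d u \<le> \<sigma> u v"
      using that by (simp add: \<sigma>_def)
  qed
  have le: "\<xi> (k - 1) \<le> \<xi> k" "\<xi> k \<le> \<xi> (k + 1)" for k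
    using \<open>mono \<xi>\<close> by (simp_all add: monoD)
  show ?thesis
  proof (rule that[of "\<lambda>k. \<sigma> (\<xi> (k - 1)) (\<xi> k)"])
    show "\<sigma> (\<xi> (k - 1)) (\<xi> k) \<le> \<sigma> (\<xi> (k + 1 - 1)) (\<xi> (k + 1))" for k
      using order_trans[OF \<sigma>_le[OF le(1)] le_\<sigma>[OF le(2)]] by simp
    show "f (\<xi> (k + 1)) - f (\<xi> k) = \<sigma> (\<xi> (k + 1 - 1)) (\<xi> (k + 1)) * (\<xi> (k + 1) - \<xi> k)" for k
      by (simp add: \<sigma>_def)
  qed
qed

section \<open>B-splines and their tail sums\<close>

lemma summation_by_parts:
  fixes c T :: "nat \<Rightarrow> real"
  assumes "m \<le> n"
  shows "(\<Sum>i = m..n. c i * (T i - T (i + 1)))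
    = c m * T m + (\<Sum>k = m + 1..n. (c k - c (k - 1)) * T k) - c n * T (n + 1)"
  using assms
proof (induction n rule: dec_induct)
  case base
  show ?case
    by (simp add: right_diff_distrib)
next
  case (step n)
  have "(\<Sum>k = m + 1..Suc n. (c k - c (k - 1)) * T k)
      = (\<Sum>k = m + 1..n. (c k - c (k - 1)) * T k) + (c (n + 1) - c n) * T (n + 1)"
    using step.hyps by simp
  moreover have "(\<Sum>i = m..Suc n. c i * (T i - T (i + 1)))
      = (\<Sum>i = m..n. c i * (T i - T (i + 1))) + c (n + 1) * (T (n + 1) - T (n + 1 + 1))"
    using step.hyps by simp
  ultimately show ?case
    unfolding step.IH by (simp only: ring_distribs Suc_eq_plus1)
qed

text \<open>
  \<open>bspline_tail x q k\<close> is $\sum_{i \ge k} B_{i,q}$ for an unbounded knot sequence.  Adding the B-spline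
  recurrences for all $i \ge k$, the two factors of each $B_{i,q}$ with $i > k$ sum to $1$, so that only
  $B_{k,q}$ keeps a factor.  Taking the resulting recursion as the definition avoids infinite sums and a
  dependence on the last knot.
\<close>
fun bspline_tail :: "(nat \<Rightarrow> real) \<Rightarrow> nat \<Rightarrow> nat \<Rightarrow> real \<Rightarrow> real" where
  "bspline_tail x 0 k u = (if x k \<le> u then 1 else 0)"
| "bspline_tail x (Suc q) k u =
     bspline_tail x q (k + 1) u + (u - x k) / (x (k + q + 1) - x k) * bspline x q k u"

lemma bspline_cong:
  assumes "\<And>j. i \<le> j \<Longrightarrow> j \<le> i + p + 1 \<Longrightarrow> x j = y j"
  shows "bspline x p i u = bspline y p i u"
  using assms
proof (induction p arbitrary: i)
  case (Suc p)
  have "bspline x p i u = bspline y p i u" "bspline x p (i + 1) u = bspline y p (i + 1) u"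
    by (rule Suc.IH; simp add: Suc.prems)+
  then show ?case
    by (simp add: Suc.prems)
qed simp

text \<open>
  The operator \<open>Lim\<close> has an unspecified value if there is no limit, so existence must be known before
  the value at the right end point can be computed.
\<close>
lemma bspline_left_limit_exists: "\<exists>L. (bspline x p i \<longlongrightarrow> L) (at_left u)"
proof (induction p arbitrary: i)
  case 0
  have lim: "((\<lambda>v. if c \<le> v then 1 else 0 :: real) \<longlongrightarrow> (if c < u then 1 else 0)) (at_left u)" for c
  proof (cases "c < u")
    case True
    have "\<forall>\<^sub>F v in at_left u. v \<in> {c<..<u}"
      using True by (rule eventually_at_leftI[rotated]) auto
    then show ?thesis
      using True by (intro tendsto_eventually) (auto elim!: eventually_mono)
  next
    case False
    have "\<forall>\<^sub>F v in at_left u. v < u"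
      by (simp add: eventually_at_filter)
    then show ?thesis
      using False by (intro tendsto_eventually) (auto elim!: eventually_mono)
  qed
  have "bspline x 0 i = (\<lambda>v. (if x i \<le> v then 1 else 0) * (1 - (if x (i + 1) \<le> v then 1 else 0)))"
    by auto
  then show ?case
    by (simp only:) (rule exI, rule tendsto_mult[OF lim tendsto_diff[OF tendsto_const lim]])
next
  case (Suc p)
  obtain L M where lim: "(bspline x p i \<longlongrightarrow> L) (at_left u)"
      "(bspline x p (i + 1) \<longlongrightarrow> M) (at_left u)"
    using Suc.IH by metis
  have "bspline x (Suc p) i =
      (\<lambda>v. (v - x i) * inverse (x (i + p + 1) - x i) * bspline x p i v
        + (x (i + p + 2) - v) * inverse (x (i + p + 2) - x (i + 1)) * bspline x p (i + 1) v)"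
    by (auto simp: divide_inverse)
  moreover have "((\<lambda>v. (v - x i) * inverse (x (i + p + 1) - x i) * bspline x p i v
        + (x (i + p + 2) - v) * inverse (x (i + p + 2) - x (i + 1)) * bspline x p (i + 1) v)
      \<longlongrightarrow> (u - x i) * inverse (x (i + p + 1) - x i) * L
        + (x (i + p + 2) - u) * inverse (x (i + p + 2) - x (i + 1)) * M) (at_left u)"
    by (intro tendsto_intros lim)
  ultimately show ?case
    by (simp only:) (rule exI)
qed

context
  fixes x :: "nat \<Rightarrow> real"
  assumes mono_x: "mono x"
begin

lemma knots_le: "i \<le> j \<Longrightarrow> x i \<le> x j"
  using mono_x by (rule monoD)

lemma bspline_local_support: "u < x i \<or> x (i + p + 1) \<le> u \<Longrightarrow> bspline x p i u = 0"
proof (induction p arbitrary: i)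
  case (Suc p)
  have "u < x i \<or> x (i + p + 1) \<le> u" "u < x (i + 1) \<or> x (i + 1 + p + 1) \<le> u"
    using Suc.prems knots_le[of "i + p + 1" "i + p + 2"] knots_le[of i "i + 1"] by auto
  then have "bspline x p i u = 0" "bspline x p (i + 1) u = 0"
    using Suc.IH by blast+
  then show ?case
    by simp
qed auto

lemma bspline_nonneg: "0 \<le> bspline x p i u"
proof (induction p arbitrary: i)
  case (Suc p)
  have "0 \<le> (u - x i) / (x (i + p + 1) - x i) * bspline x p i u"
  proof (cases "x i \<le> u")
    case True
    then show ?thesis
      using Suc.IH[of i] knots_le[of i "i + p + 1"] by (intro mult_nonneg_nonneg divide_nonneg_nonneg) auto
  next
    case False
    then show ?thesis
      using bspline_local_support[of u i p] by simp
  qed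
  moreover have "0 \<le> (x (i + p + 2) - u) / (x (i + p + 2) - x (i + 1)) * bspline x p (i + 1) u"
  proof (cases "u < x (i + p + 2)")
    case True
    then show ?thesis
      using Suc.IH[of "i + 1"] knots_le[of "i + 1" "i + p + 2"]
      by (intro mult_nonneg_nonneg divide_nonneg_nonneg) auto
  next
    case False
    then show ?thesis
      using bspline_local_support[of u "i + 1" p] by simp
  qed
  ultimately show ?case
    by simp
qed simp

lemma bspline_tail_diff: "bspline_tail x q k u - bspline_tail x q (k + 1) u = bspline x q k u"
proof (induction q arbitrary: k)
  case 0
  then show ?case
    using knots_le[of k "k + 1"] by auto
next
  case (Suc q)
  let ?h = "x (k + q + 2) - x (k + 1)"
  have "bspline x q (k + 1) u - (u - x (k + 1)) / ?h * bspline x q (k + 1) u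
      = (x (k + q + 2) - u) / ?h * bspline x q (k + 1) u"
  proof (cases "?h = 0")
    case True
    then show ?thesis
      using bspline_local_support[of u "k + 1" q] by (cases "u < x (k + 1)") auto
  next
    case False
    then show ?thesis
      by (simp add: field_simps)
  qed
  then show ?case
    using Suc.IH[of "k + 1"] by simp
qed

lemma bspline_tail_eq_0: "u < x k \<Longrightarrow> bspline_tail x q k u = 0"
proof (induction q arbitrary: k)
  case (Suc q)
  then show ?case
    using knots_le[of k "k + 1"] bspline_local_support[of u k q] by simp
qed simp

lemma bspline_tail_eq_1: "x (k + q) \<le> u \<Longrightarrow> bspline_tail x q k u = 1"
proof (induction q arbitrary: k)
  case (Suc q)
  then show ?case
    using bspline_local_support[of u k q] by simp
qed simp

lemma bspline_tail_degenerate: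
  "x k = x (k + q) \<Longrightarrow> bspline_tail x q k u = (if x k \<le> u then 1 else 0)"
  using bspline_tail_eq_0[of u k q] bspline_tail_eq_1[of k q u] by auto

text \<open>
  The recursion as an affine combination of two tails of the lower degree.  The purpose of
  this form is that each factor vanishes at the only point where the tail next to it can jump.
\<close>
lemma bspline_tail_interpolation:
  assumes "x k < x (k + q + 1)"
  shows "bspline_tail x (Suc q) k u =
    (u - x k) / (x (k + q + 1) - x k) * bspline_tail x q k u
    + (x (k + q + 1) - u) / (x (k + q + 1) - x k) * bspline_tail x q (k + 1) u"
proof -
  have "bspline_tail x q (k + 1) u
      = ((u - x k) / (x (k + q + 1) - x k) + (x (k + q + 1) - u) / (x (k + q + 1) - x k))
        * bspline_tail x q (k + 1) u"
    using assms by (simp flip: add_divide_distrib)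
  then show ?thesis
    unfolding bspline_tail.simps(2) bspline_tail_diff[symmetric] by (simp only: algebra_simps)
qed

text \<open>
  In the interpolation formula a lower tail is discontinuous only if it is a step function, and its jump
  is at the zero of its factor: the product is then a positive or negative part of an affine function.
\<close>
lemma bspline_tail_continuous:
  "x k < x (k + q) \<Longrightarrow> continuous_on UNIV (bspline_tail x q k)"
proof (induction q arbitrary: k)
  case (Suc q)
  let ?h = "x (k + q + 1) - x k"
  have "0 < ?h"
    using Suc.prems by simp
  have left: "continuous_on UNIV (\<lambda>u. (u - x k) / ?h * bspline_tail x q k u)"
  proof (cases "x k < x (k + q)")
    case True
    then show ?thesis
      using \<open>0 < ?h\<close> by (intro continuous_intros Suc.IH) auto
  next
    case False
    then have "x k = x (k + q)"
      using knots_le[of k "k + q"] by simp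
    then have "(\<lambda>u. (u - x k) / ?h * bspline_tail x q k u) = (\<lambda>u. max 0 (u - x k) / ?h)"
      by (auto simp: bspline_tail_degenerate max_def)
    then show ?thesis
      using \<open>0 < ?h\<close> by (simp only:) (intro continuous_intros, auto)
  qed
  have right: "continuous_on UNIV (\<lambda>u. (x (k + q + 1) - u) / ?h * bspline_tail x q (k + 1) u)"
  proof (cases "x (k + 1) < x (k + 1 + q)")
    case True
    then show ?thesis
      using \<open>0 < ?h\<close> by (intro continuous_intros Suc.IH) auto
  next
    case False
    then have eq: "x (k + 1) = x (k + 1 + q)"
      using knots_le[of "k + 1" "k + 1 + q"] by simp
    then have "(\<lambda>u. (x (k + q + 1) - u) / ?h * bspline_tail x q (k + 1) u)
        = (\<lambda>u. min 0 (x (k + q + 1) - u) / ?h)"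
      using bspline_tail_degenerate[OF eq] by (auto simp: min_def add_ac)
    then show ?thesis
      using \<open>0 < ?h\<close> by (simp only:) (intro continuous_intros, auto)
  qed
  have "bspline_tail x (Suc q) k = (\<lambda>u. (u - x k) / ?h * bspline_tail x q k u
      + (x (k + q + 1) - u) / ?h * bspline_tail x q (k + 1) u)"
    using bspline_tail_interpolation[of k q] \<open>0 < ?h\<close> by (intro ext) simp
  then show ?case
    using continuous_on_add[OF left right] by simp
qed simp

text \<open>
  Differentiating $T_{k,q+1} = T_{k+1,q} + \omega\, (T_{k,q} - T_{k+1,q})$ with
  $\omega(u) = (u - x_k) / (x_{k+q+1} - x_k)$, the terms without $\omega'$ are, by induction, $q$ times
  the B-spline recurrence for $B_{k,q}$ divided by $x_{k+q+1} - x_k$; the term with $\omega'$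
  contributes $B_{k,q}$ over the same denominator once more.  For $q = 0$ the convention \<open>q - 1 = 0\<close> is
  harmless because of the factor $q$.
\<close>
lemma bspline_tail_has_derivative:
  assumes "u \<notin> x ` {k..k + q}"
  shows "(bspline_tail x q k has_real_derivative
    real q / (x (k + q) - x k) * bspline x (q - 1) k u) (at u)"
  using assms
proof (induction q arbitrary: k)
  case 0
  then consider "u < x k" | "x k < u"
    by fastforce
  then have "((\<lambda>v. if x k \<le> v then 1 else 0 :: real) has_real_derivative 0) (at u)"
  proof cases
    case 1
    show ?thesis
      by (rule has_field_derivative_transform_within_open[of "\<lambda>_. 0" _ _ "{..<x k}"]) (use 1 in auto)
  next
    case 2
    show ?thesis
      by (rule has_field_derivative_transform_within_open[of "\<lambda>_. 1" _ _ "{x k<..}"]) (use 2 in auto)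
  qed
  moreover have "bspline_tail x 0 k = (\<lambda>v. if x k \<le> v then 1 else 0)"
    by auto
  ultimately show ?case
    by simp
next
  case (Suc q)
  let ?h = "x (k + q + 1) - x k"
  let ?D = "\<lambda>k. real q / (x (k + q) - x k) * bspline x (q - 1) k u"
  have eq: "bspline_tail x (Suc q) k = (\<lambda>u. bspline_tail x q (k + 1) u
      + (u - x k) / ?h * (bspline_tail x q k u - bspline_tail x q (k + 1) u))"
    by (intro ext) (simp only: bspline_tail.simps bspline_tail_diff)
  have lin: "((\<lambda>u. (u - x k) / ?h) has_real_derivative 1 / ?h) (at u)"
    by (intro DERIV_cdivide) (auto intro!: derivative_eq_intros)
  have D0: "(bspline_tail x q k has_real_derivative ?D k) (at u)"
    by (rule Suc.IH) (use Suc.prems in auto)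
  have D1: "(bspline_tail x q (k + 1) has_real_derivative ?D (k + 1)) (at u)"
    by (rule Suc.IH) (use Suc.prems in auto)
  have "(bspline_tail x (Suc q) k has_real_derivative
      ?D (k + 1) + (1 / ?h * bspline x q k u + (u - x k) / ?h * (?D k - ?D (k + 1)))) (at u)"
    using DERIV_add[OF D1 DERIV_mult'[OF lin DERIV_diff[OF D0 D1]]]
    unfolding eq bspline_tail_diff by (simp add: add_ac mult_ac)
  moreover have "?D (k + 1) + (1 / ?h * bspline x q k u + (u - x k) / ?h * (?D k - ?D (k + 1)))
      = real (Suc q) / (x (k + Suc q) - x k) * bspline x (Suc q - 1) k u"
  proof (cases "?h = 0")
    case True
    then have "x (k + 1 + q) = x (k + 1)"
      using knots_le[of k "k + 1"] knots_le[of "k + 1" "k + 1 + q"] by simp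
    then show ?thesis
      using True by simp
  next
    case False
    have "?D (k + 1) + (u - x k) / ?h * (?D k - ?D (k + 1)) = real q / ?h * bspline x q k u"
    proof (cases q)
      case 0
      then show ?thesis by simp
    next
      case (Suc r)
      have split: "E + (u - x k) / ?h * (D - E) = ((u - x k) * D + (x (k + q + 1) - u) * E) / ?h" for D E
        using False by (simp add: field_simps)
      show ?thesis
        unfolding split using False Suc by (simp add: field_simps)
    qed
    then show ?thesis
      by (simp add: add_divide_distrib ring_distribs)
  qed
  ultimately show ?case
    by (simp only:)
qed

text \<open>
  If $x_k = x_{k+q}$, the derivative formula does not see the jump at $x_k$; the tail is then explicitly
  a unit step.
\<close>
lemma bspline_tail_mono: "mono (bspline_tail x q k)"
proof (cases "x k < x (k + q)")
  case True
  show ?thesis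
  proof (rule monoI)
    fix u v :: real
    assume "u \<le> v"
    have "0 * (v - u) \<le> bspline_tail x q k v - bspline_tail x q k u"
    proof (rule increment_ge_of_derivative_ge[where S = "x ` {k..k + q}"])
      show "continuous_on {u..v} (bspline_tail x q k)"
        using bspline_tail_continuous[OF True] continuous_on_subset by blast
      show "(bspline_tail x q k has_real_derivative
          real q / (x (k + q) - x k) * bspline x (q - 1) k t) (at t)"
        if "t \<in> {u<..<v} - x ` {k..k + q}" for t
        using that bspline_tail_has_derivative by blast
      show "0 \<le> real q / (x (k + q) - x k) * bspline x (q - 1) k t" for t
        using bspline_nonneg True by simp
    qed (use \<open>u \<le> v\<close> in auto)
    then show "bspline_tail x q k u \<le> bspline_tail x q k v"
      by simp
  qed
next
  case False
  then have "x k = x (k + q)"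
    using knots_le[of k "k + q"] by simp
  then show ?thesis
    by (auto intro!: monoI simp: bspline_tail_degenerate)
qed

text \<open>
  The bounds on \<open>u\<close> make the first boundary term of the summation by parts \<open>c m\<close> and the last one \<open>0\<close>.
  For constant \<open>c\<close> this is the partition of unity.
\<close>
lemma sum_bspline_eq:
  assumes "m \<le> n" and "x (m + q) \<le> u" and "u < x (n + 1)"
  shows "(\<Sum>i = m..n. c i * bspline x q i u)
    = c m + (\<Sum>k = m + 1..n. (c k - c (k - 1)) * bspline_tail x q k u)"
  using summation_by_parts[OF assms(1), of c "\<lambda>k. bspline_tail x q k u"]
    bspline_tail_eq_1[OF assms(2)] bspline_tail_eq_0[OF assms(3)]
  unfolding bspline_tail_diff by simp

section \<open>Splines whose coefficients sample a convex function\<close>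

lemma knot_average_step:
  assumes "1 \<le> k"
  shows "knot_average x p k - knot_average x p (k - 1) = (x (k + p) - x k) / real p"
proof (cases p)
  case 0
  then show ?thesis by (simp add: knot_average_def)
next
  case (Suc q)
  have "(\<Sum>j = k + 1..k + Suc q. x j) + x k = (\<Sum>j = k - 1 + 1..k - 1 + Suc q. x j) + x (k + Suc q)"
    using \<open>1 \<le> k\<close> sum.atLeast_Suc_atMost[of k "k + q" x] by simp
  then show ?thesis
    using Suc by (simp add: knot_average_def flip: diff_divide_distrib)
qed

lemma knot_average_mono: "mono (knot_average x p)"
proof (subst mono_iff_le_Suc, rule allI)
  fix k
  show "knot_average x p k \<le> knot_average x p (Suc k)"
  proof -
    have "0 \<le> (x (Suc k + p) - x (Suc k)) / real p"
      using knots_le[of "Suc k" "Suc k + p"] by (intro divide_nonneg_nonneg) auto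
    also have "\<dots> = knot_average x p (Suc k) - knot_average x p k"
      using knot_average_step[of "Suc k" p] by simp
    finally show ?thesis
      by simp
  qed
qed

text \<open>
  The function in question is the tail form of the spline.  It is continuous on the whole line,
  whereas the B-spline sum itself agrees with it only on a half-open interval and drops to $0$ at the
  right end point.
\<close>
lemma convex_on_spline:
  assumes "1 \<le> p" and "p + 1 \<le> n" and "convex_on UNIV f"
  shows "convex_on {x (p + 1)..x (n + 1)} (\<lambda>u. f (knot_average x p 1)
    + (\<Sum>k = 2..n. (f (knot_average x p k) - f (knot_average x p (k - 1))) * bspline_tail x p k u))"
    (is "convex_on _ ?F")
  and "continuous_on UNIV (\<lambda>u. f (knot_average x p 1)
    + (\<Sum>k = 2..n. (f (knot_average x p k) - f (knot_average x p (k - 1))) * bspline_tail x p k u))"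
proof -
  let ?\<xi> = "knot_average x p"
  obtain s where s_le: "\<And>k. s k \<le> s (k + 1)"
    and s: "\<And>k. f (?\<xi> (k + 1)) - f (?\<xi> k) = s (k + 1) * (?\<xi> (k + 1) - ?\<xi> k)"
    using convex_on_obtains_slopes[OF assms(3) knot_average_mono] by metis
  have slope: "f (?\<xi> k) - f (?\<xi> (k - 1)) = s k * ((x (k + p) - x k) / real p)" if "1 \<le> k" for k
    using s[of "k - 1"] knot_average_step[OF that, of p] that by simp
  have summand: "continuous_on UNIV (\<lambda>u. (f (?\<xi> k) - f (?\<xi> (k - 1))) * bspline_tail x p k u)" if "1 \<le> k" for k
  proof (cases "x k < x (k + p)")
    case True
    then show ?thesis
      by (intro continuous_intros bspline_tail_continuous)
  next
    case False
    then have "x (k + p) - x k = 0"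
      using knots_le[of k "k + p"] by simp
    then show ?thesis
      unfolding slope[OF that] by simp
  qed
  then show cont: "continuous_on UNIV ?F"
    by (intro continuous_on_add continuous_on_sum continuous_on_const summand) simp
  \<comment> \<open>The derivative $\sum_k s_k B_{k,p-1}$ in tail form; unlike the sum it is increasing beyond
    the last knot too.\<close>
  define g where "g t = s 2 + (\<Sum>k = 2 + 1..n. (s k - s (k - 1)) * bspline_tail x (p - 1) k t)" for t
  show "convex_on {x (p + 1)..x (n + 1)} ?F"
  proof (rule convex_on_of_mono_derivative[where S = "x ` {0..n + p}" and g = g])
    show "continuous_on {x (p + 1)..x (n + 1)} ?F"
      using cont continuous_on_subset by blast
    show "mono g"
    proof (rule monoI)
      fix t u :: real
      assume "t \<le> u"
      have "(s k - s (k - 1)) * bspline_tail x (p - 1) k t \<le> (s k - s (k - 1)) * bspline_tail x (p - 1) k u"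
        if "k \<in> {2 + 1..n}" for k
        using that s_le[of "k - 1"] monoD[OF bspline_tail_mono \<open>t \<le> u\<close>]
        by (intro mult_left_mono) auto
      then show "g t \<le> g u"
        unfolding g_def by (intro add_left_mono sum_mono)
    qed
    fix t
    assume t: "t \<in> {x (p + 1)<..<x (n + 1)} - x ` {0..n + p}"
    have "(?F has_real_derivative 0 + (\<Sum>k = 2..n. (f (?\<xi> k) - f (?\<xi> (k - 1)))
        * (real p / (x (k + p) - x k) * bspline x (p - 1) k t))) (at t)"
      using t by (intro DERIV_add DERIV_const DERIV_sum DERIV_cmult bspline_tail_has_derivative) auto
    moreover have "(f (?\<xi> k) - f (?\<xi> (k - 1))) * (real p / (x (k + p) - x k) * bspline x (p - 1) k t)
        = s k * bspline x (p - 1) k t" if "k \<in> {2..n}" for k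
    proof (cases "x (k + p) = x k")
      case True
      then show ?thesis
        using bspline_local_support[of t k "p - 1"] \<open>1 \<le> p\<close> by (cases "t < x k") auto
    next
      case False
      have "1 \<le> k"
        using that by simp
      show ?thesis
        unfolding slope[OF \<open>1 \<le> k\<close>] using False \<open>1 \<le> p\<close> by simp
    qed
    moreover have "(\<Sum>k = 2..n. s k * bspline x (p - 1) k t) = g t"
      unfolding g_def using assms t by (intro sum_bspline_eq) auto
    ultimately show "(?F has_real_derivative g t) (at t)"
      by simp
  qed simp
qed

lemma convex_on_spline_eval:
  assumes "1 \<le> p" and "p + 1 \<le> n" and "x (p + 1) < x (n + 1)" and "convex_on UNIV f"
  shows "convex_on {x (p + 1)..x (n + 1)}
    (\<lambda>u. \<Sum>i = 1..n. f (knot_average x p i) * bspline_eval x p n i u)"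
proof -
  let ?a = "x (p + 1)" and ?b = "x (n + 1)"
  let ?f = "\<lambda>u. \<Sum>i = 1..n. f (knot_average x p i) * bspline x p i u"
  let ?e = "\<lambda>u. \<Sum>i = 1..n. f (knot_average x p i) * bspline_eval x p n i u"
  define F where "F u = f (knot_average x p 1)
    + (\<Sum>k = 2..n. (f (knot_average x p k) - f (knot_average x p (k - 1))) * bspline_tail x p k u)" for u
  have F: "convex_on {?a..?b} F" "continuous_on UNIV F"
    unfolding F_def using convex_on_spline[OF assms(1,2,4)] by auto
  have eq: "?f u = F u" if "?a \<le> u" "u < ?b" for u
    using sum_bspline_eq[of 1 n p u "\<lambda>i. f (knot_average x p i)"] that assms
    unfolding F_def by (simp add: add.commute numeral_2_eq_2)
  have "(bspline x p i \<longlongrightarrow> bspline_eval x p n i ?b) (at_left ?b)" for i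
    using bspline_left_limit_exists[of x p i ?b] tendsto_Lim[of "at_left ?b"]
    by (auto simp: bspline_eval_def)
  then have "(?f \<longlongrightarrow> ?e ?b) (at_left ?b)"
    by (intro tendsto_intros)
  moreover have "(?f \<longlongrightarrow> F ?b) (at_left ?b)"
  proof (rule Lim_transform_eventually)
    show "(F \<longlongrightarrow> F ?b) (at_left ?b)"
      using F(2) by (meson UNIV_I at_le continuous_on_def subset_UNIV tendsto_mono)
    have "\<forall>\<^sub>F u in at_left ?b. u \<in> {?a<..<?b}"
      using assms(3) by (rule eventually_at_leftI[rotated]) auto
    then show "\<forall>\<^sub>F u in at_left ?b. F u = ?f u"
      by (rule eventually_mono) (rule eq[symmetric], auto)
  qed
  ultimately have "?e ?b = F ?b"
    using tendsto_unique[of "at_left ?b"] by simp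
  moreover have "?e u = F u" if "?a \<le> u" "u < ?b" for u
    using eq[OF that] that by (simp add: bspline_eval_def)
  ultimately have e: "?e u = F u" if "u \<in> {?a..?b}" for u
    using that by (cases "u = ?b") auto
  show ?thesis
    by (rule convex_on_eq[OF _ F(1)]) (rule e)
qed

end

text \<open>
  The knot sequence is monotone only at the relevant indices.  Freezing it outside of them makes it
  monotone everywhere and changes neither the B-splines nor the knot averages in use.
\<close>
lemma convex_on_wqisa:
  assumes "1 \<le> p" and "regular_knots p n x" and "w_convex w P"
  shows "convex_on {x (p + 1)..x (n + 1)} (wqisa P w p n x)"
proof -
  define z where "z j = x (max 1 (min j (n + p + 1)))" for j
  have mono: "mono_on {1..n + p + 1} x" and "p + 1 \<le> n" and "x 1 = x (p + 1)" and "x 1 < x (1 + p + 1)"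
    using assms(2) unfolding regular_knots_def by (blast, blast, blast, fastforce)
  have "x (1 + p + 1) \<le> x (n + 1)"
    using mono \<open>p + 1 \<le> n\<close> by (auto intro: mono_onD)
  have z: "z j = x j" if "1 \<le> j" "j \<le> n + p + 1" for j
    using that by (simp add: z_def)
  have "mono z"
    unfolding z_def by (intro monoI mono_onD[OF mono]) auto
  have eval: "bspline_eval z p n i u = bspline_eval x p n i u" if "i \<in> {1..n}" for i u
  proof -
    have "bspline z p i = bspline x p i"
      using that by (intro ext bspline_cong z) auto
    then show ?thesis
      using z[of "n + 1"] by (simp add: bspline_eval_def)
  qed
  have average: "knot_average z p i = knot_average x p i" if "i \<in> {1..n}" for i
    unfolding knot_average_def using that z by (intro arg_cong2[where f = "(/)"] sum.cong) auto
  have "convex_on UNIV (estimator P w)"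
    using assms(3) by (intro convex_on_linorderI) (auto simp: w_convex_def)
  then have "convex_on {z (p + 1)..z (n + 1)}
      (\<lambda>u. \<Sum>i = 1..n. estimator P w (knot_average z p i) * bspline_eval z p n i u)"
    using \<open>mono z\<close> \<open>1 \<le> p\<close> \<open>p + 1 \<le> n\<close> \<open>x 1 = x (p + 1)\<close> \<open>x 1 < x (1 + p + 1)\<close>
      \<open>x (1 + p + 1) \<le> x (n + 1)\<close>
    by (intro convex_on_spline_eval) (simp_all add: z)
  moreover have "(\<Sum>i = 1..n. estimator P w (knot_average z p i) * bspline_eval z p n i u)
      = wqisa P w p n x u" for u
    unfolding wqisa_def by (intro sum.cong) (simp_all add: eval average)
  ultimately show ?thesis
    using \<open>p + 1 \<le> n\<close> by (simp add: z)
qed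

lemma estimator_uminus: "estimator ((\<lambda>(x, y). (x, - y)) ` P) w t = - estimator P w t"
proof -
  have "inj_on (\<lambda>(x :: real, y :: real). (x, - y)) P"
    by (auto simp: inj_on_def)
  then show ?thesis
    by (simp add: estimator_def sum.reindex case_prod_unfold sum_negf)
qed

lemma wqisa_uminus: "wqisa ((\<lambda>(x, y). (x, - y)) ` P) w p n x u = - wqisa P w p n x u"
  by (simp add: wqisa_def estimator_uminus sum_negf)

theorem propositionA6:
  fixes P :: "(real \<times> real) set"
    and w :: "real \<Rightarrow> real \<Rightarrow> real"
    and p n :: nat
    and x :: "nat \<Rightarrow> real"
    and a b :: real
  assumes "finite P" and "P \<noteq> {}"
    and "1 \<le> p"
    and "regular_knots p n x"
    and "x (p + 1) = a" and "x (n + 1) = b"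
    and "\<And>t s. 0 \<le> w t s"
    and "\<And>t. 0 < (\<Sum>(s, y)\<in>P. w t s)"
  shows "(w_convex w P \<longrightarrow> convex_on {a..b} (wqisa P w p n x)) \<and>
         (w_concave w P \<longrightarrow> concave_on {a..b} (wqisa P w p n x))"
proof (intro conjI impI)
  assume "w_convex w P"
  then show "convex_on {a..b} (wqisa P w p n x)"
    using convex_on_wqisa assms(3-6) by blast
next
  assume "w_concave w P"
  then have "convex_on {a..b} (wqisa ((\<lambda>(x, y). (x, - y)) ` P) w p n x)"
    unfolding w_concave_def using convex_on_wqisa assms(3-6) by blast
  then show "concave_on {a..b} (wqisa P w p n x)"
    by (simp add: concave_on_def wqisa_uminus[abs_def])
qed

end
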